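(* For every positive integer $n$, the number $\widetilde{V}(n)$ of valved minimal bridges from $(0,0)$ to $(3n,2n)$ satisfies $$\widetilde{V}(n)=6\,\widetilde{D}(n)-\frac{4}{5n-1}\binom{5n-1}{2n},$$ where $\widetilde{D}(n)$ is the number of minimal Duchon paths from $(0,0)$ to $(3n,2n)$.
   Context: All paths are lattice paths in $\mathbb{Z}^2$ composed only of unit steps to the right $(1,0)$ and up $(0,1)$. The diagonal is the line $y=2x/3$. A bridge is a path from $(0,0)$ to $(3n,2n)$. A minimal bridge is a nontrivial bridge that contains no lattice points on the diagonal other than its two endpoints. A minimal Duchon path is a minimal excursion with respect to $y=2x/3$, i.e. a bridge all of whose lattice points other than the two endpoints lie strictly above the diagonal. A valved path is a path that does not cross from on or above the diagonal to below the diagonal, except possibly with its first step; equivalently, no right step other than possibly the first step of the path starts at a point on or above the diagonal and ends at a point strictly below the diagonal. A valved minimal bridge is a minimal bridge that is also a valved path. *)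

theory Defs
  imports Complex_Main "HOL-Library.Product_Plus"
begin

datatype step = Right | Up

primrec displacement :: "step \<Rightarrow> int \<times> int" where
  "displacement Right = (1, 0)"
| "displacement Up = (0, 1)"

text \<open>
  A lattice path starting at the origin is encoded by its word of steps; the empty word is the
  trivial path.  Since all steps are unit steps, the lattice points lying on a path \<open>p\<close> are exactly
  its vertices \<open>vertex p i\<close> with \<open>i \<le> length p\<close>, and the \<open>i\<close>-th step \<open>p ! i\<close>
  (counting from \<open>0\<close>) goes from \<open>vertex p i\<close> to \<open>vertex p (Suc i)\<close>.
\<close>

type_synonym path = "step list"

definition vertex :: "path \<Rightarrow> nat \<Rightarrow> int \<times> int" where
  "vertex p i = sum_list (map displacement (take i p))"

definition on_diagonal :: "int \<times> int \<Rightarrow> bool" where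
  "on_diagonal z \<longleftrightarrow> real_of_int (snd z) = 2 * real_of_int (fst z) / 3"

definition above_diagonal :: "int \<times> int \<Rightarrow> bool" where
  "above_diagonal z \<longleftrightarrow> real_of_int (snd z) > 2 * real_of_int (fst z) / 3"

definition below_diagonal :: "int \<times> int \<Rightarrow> bool" where
  "below_diagonal z \<longleftrightarrow> real_of_int (snd z) < 2 * real_of_int (fst z) / 3"

definition bridge :: "nat \<Rightarrow> path \<Rightarrow> bool" where
  "bridge n p \<longleftrightarrow> vertex p (length p) = (3 * int n, 2 * int n)"

definition minimal_bridge :: "nat \<Rightarrow> path \<Rightarrow> bool" where
  "minimal_bridge n p \<longleftrightarrow> bridge n p \<and> p \<noteq> [] \<and>
     (\<forall>i. 0 < i \<and> i < length p \<longrightarrow> \<not> on_diagonal (vertex p i))"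

definition minimal_Duchon_path :: "nat \<Rightarrow> path \<Rightarrow> bool" where
  "minimal_Duchon_path n p \<longleftrightarrow> bridge n p \<and> p \<noteq> [] \<and>
     (\<forall>i. 0 < i \<and> i < length p \<longrightarrow> above_diagonal (vertex p i))"

text \<open>The first step, of index \<open>0\<close>, is exempt from the condition.\<close>

definition valved_path :: "path \<Rightarrow> bool" where
  "valved_path p \<longleftrightarrow>
     (\<forall>i. 0 < i \<and> i < length p \<and> p ! i = Right \<and>
          (on_diagonal (vertex p i) \<or> above_diagonal (vertex p i))
          \<longrightarrow> \<not> below_diagonal (vertex p (Suc i)))"

definition valved_minimal_bridge :: "nat \<Rightarrow> path \<Rightarrow> bool" where
  "valved_minimal_bridge n p \<longleftrightarrow> minimal_bridge n p \<and> valved_path p"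

definition num_valved_minimal_bridges :: "nat \<Rightarrow> nat" where
  "num_valved_minimal_bridges n = card {p. valved_minimal_bridge n p}"

definition num_minimal_Duchon_paths :: "nat \<Rightarrow> nat" where
  "num_minimal_Duchon_paths n = card {p. minimal_Duchon_path n p}"

text \<open>The sets being counted are finite, so \<^const>\<open>card\<close> is their true cardinality.\<close>

lemma sum_list_displacement:
  "fst (sum_list (map displacement p)) + snd (sum_list (map displacement p)) = int (length p)"
proof (induction p)
  case (Cons s p)
  then show ?case by (cases s) simp_all
qed simp

lemma bridge_length: "bridge n p \<Longrightarrow> length p = 5 * n"
  using sum_list_displacement[of p] by (simp add: bridge_def vertex_def)

lemma finite_bridges: "finite {p. bridge n p}"
proof (rule finite_subset)
  have "s \<in> {Right, Up}" for s by (cases s) simp_all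
  then show "{p. bridge n p} \<subseteq> {p. set p \<subseteq> {Right, Up} \<and> length p = 5 * n}"
    by (auto dest: bridge_length)
qed (simp add: finite_lists_length_eq)

lemma finite_valved_minimal_bridges: "finite {p. valved_minimal_bridge n p}"
  by (rule finite_subset[OF _ finite_bridges[of n]])
    (auto simp: valved_minimal_bridge_def minimal_bridge_def)

lemma finite_minimal_Duchon_paths: "finite {p. minimal_Duchon_path n p}"
  by (rule finite_subset[OF _ finite_bridges[of n]]) (auto simp: minimal_Duchon_path_def)

end

theory Submission
  imports Defs
begin

text \<open>
  Measure a vertex \<open>(x, y)\<close> by its height \<open>3y - 2x\<close>, so that steps raise the height by \<open>3\<close> or lower it
  by \<open>2\<close>. A minimal bridge never has inner height \<open>0\<close>, so a valved one changes sign at most once, from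
  negative to positive: it is a minimal Duchon path, the reversal of one, or of the form
  \<open>rev u @ Up # v\<close>, where \<open>u\<close> and \<open>v\<close> descend to their first zero from heights \<open>2\<close> and \<open>1\<close>, in either
  order. Cutting a minimal Duchon path that visits height \<open>1\<close> at its first such visit writes it as
  \<open>Up # u @ v\<close> with \<open>u\<close> descending from \<open>2\<close> and \<open>v\<close> from \<open>1\<close>. Hence if \<open>E\<close> counts the minimal Duchon
  paths with inner heights at least \<open>2\<close>, there are \<open>2D + 2(D - E) = 6D - 2(D + E)\<close> valved minimal
  bridges. Dropping the last step turns \<open>D + E\<close> into a count of words of length \<open>5n - 1\<close> and total
  height \<open>2\<close>, which a cycle lemma evaluates as \<open>2 / (5n - 1)\<close> times the number of all such words.
\<close>

section \<open>A cycle lemma\<close>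

text \<open>Let \<open>M i\<close> be the minimum of \<open>H\<close> over the \<open>m\<close>
  indices from \<open>i\<close> on. The admissible \<open>c\<close> at \<open>i\<close> are those
  from 1 to \<open>M (Suc i) - H i\<close>; there are \<open>M (Suc i) - M i\<close> of them, and
  these jumps telescope to \<open>M m - M 0 = d\<close>.\<close>

lemma sum_future_min_jumps:
  fixes H :: "nat \<Rightarrow> int" and d :: int and m :: nat
  assumes m: "m > 0" and d: "d \<ge> 0" and per: "\<And>i. H (i + m) = H i + d"
  shows "(\<Sum>i<m. card {c \<in> {1..d}. \<forall>j\<in>{1..m}. c \<le> H (i + j) - H i}) = nat d"
proof -
  define M where "M i = Min (H ` {i..<i + m})" for i
  have M_mem: "M i \<le> H j" if "i \<le> j" "j < i + m" for i j
    unfolding M_def using that by (intro Min_le) auto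
  have le_M: "c \<le> M i \<longleftrightarrow> (\<forall>j\<in>{i..<i + m}. c \<le> H j)" for c i
    unfolding M_def using m by (subst Min_ge_iff) auto
  have le_M_Suc: "c \<le> M (Suc i) \<longleftrightarrow> (\<forall>j\<in>{1..m}. c \<le> H (i + j))" for c i
  proof -
    have eq: "{Suc i..<Suc i + m} = (\<lambda>j. i + j) ` {1..m}"
      by (simp add: image_add_atLeastAtMost atLeastLessThanSuc_atLeastAtMost)
    show ?thesis unfolding le_M eq by blast
  qed
  have upper: "M (Suc i) \<le> H i + d" for i
    using M_mem[of "Suc i" "i + m"] m per[of i] by simp
  have jump: "M (Suc i) - M i = int (nat (M (Suc i) - H i))" for i
  proof -
    \<comment> \<open>Moving the window by one drops \<open>H i\<close> and adds
      \<open>H (i + m) = H i + d\<close>, which is no smaller because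
      \<open>d \<ge> 0\<close>.\<close>
    have "M i = min (H i) (M (Suc i))"
    proof (rule antisym)
      have "M i \<le> H (i + j)" if "j \<in> {1..m}" for j
      proof (cases "j = m")
        case True
        then show ?thesis using M_mem[of i i] m d per[of i] by simp
      next
        case False
        then show ?thesis using that by (intro M_mem) auto
      qed
      then show "M i \<le> min (H i) (M (Suc i))"
        using M_mem[of i i] m by (simp add: le_M_Suc)
      have "min (H i) (M (Suc i)) \<le> H j" if "j \<in> {i..<i + m}" for j
      proof (cases "j = i")
        case False
        then show ?thesis using M_mem[of "Suc i" j] that by simp
      qed simp
      then show "min (H i) (M (Suc i)) \<le> M i" by (simp add: le_M)
    qed
    then show ?thesis by simp
  qed
  \<comment> \<open>Periodicity gives \<open>M (Suc i) - H i \<le> d\<close>, so the interval on the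
    right stays inside \<open>{1..d}\<close>.\<close>
  have "{c \<in> {1..d}. \<forall>j\<in>{1..m}. c \<le> H (i + j) - H i} = {1..M (Suc i) - H i}" for i
  proof -
    have "(\<forall>j\<in>{1..m}. c \<le> H (i + j) - H i) \<longleftrightarrow> c \<le> M (Suc i) - H i" for c
      using le_M_Suc[of "c + H i" i] by (simp add: le_diff_eq)
    then show ?thesis using upper[of i] by force
  qed
  then have "int (\<Sum>i<m. card {c \<in> {1..d}. \<forall>j\<in>{1..m}. c \<le> H (i + j) - H i})
      = (\<Sum>i<m. M (Suc i) - M i)"
    by (simp add: jump)
  also have "\<dots> = M m - M 0" by (rule sum_lessThan_telescope)
  \<comment> \<open>The window at \<open>m\<close> is the window at 0 moved by one period.\<close>
  also have "M m = M 0 + d"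
  proof (rule antisym)
    have shift: "{m..<m + m} = (\<lambda>j. j + m) ` {0..<m}"
      by (simp add: image_add_atLeastLessThan')
    have "M m - d \<le> M 0"
      unfolding le_M
    proof
      fix j assume "j \<in> {0..<0 + m}"
      then show "M m - d \<le> H j" using M_mem[of m "j + m"] per[of j] by simp
    qed
    then show "M m \<le> M 0 + d" by simp
    show "M 0 + d \<le> M m"
      unfolding le_M shift using M_mem[of 0] by (simp add: per del: image_add_atLeastLessThan')
  qed
  finally show ?thesis using d by linarith
qed

lemma sum_list_take_rotate:
  fixes xs :: "int list"
  assumes "j \<le> length xs"
  shows "sum_list (take j (rotate i xs)) = (\<Sum>k = i..<i + j. xs ! (k mod length xs))"
proof -
  have "sum_list (take j (rotate i xs)) = (\<Sum>k<j. xs ! ((i + k) mod length xs))"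
    using assms by (simp add: sum_list_sum_nth nth_rotate atLeast0LessThan)
  also have "\<dots> = (\<Sum>k = i..<i + j. xs ! (k mod length xs))"
    using sum.shift_bounds_nat_ivl[of "\<lambda>k. xs ! (k mod length xs)" 0 i j]
    by (simp add: atLeast0LessThan add.commute)
  finally show ?thesis .
qed

text \<open>Take \<open>H\<close> to be the partial sums of the periodic extension of
  \<open>xs\<close>. One period adds \<open>sum_list xs\<close>, and the prefix sums of the
  \<open>i\<close>-th rotation are the differences \<open>H (i + j) - H i\<close>.\<close>

lemma sum_card_rotations:
  fixes xs :: "int list"
  assumes "xs \<noteq> []" and "sum_list xs \<ge> 0"
  shows "(\<Sum>i<length xs. card {c \<in> {1..sum_list xs}.
      \<forall>j\<in>{1..length xs}. c \<le> sum_list (take j (rotate i xs))}) = nat (sum_list xs)"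
proof -
  define H where "H i = (\<Sum>k<i. xs ! (k mod length xs))" for i
  have diff: "H (i + j) - H i = (\<Sum>k = i..<i + j. xs ! (k mod length xs))" for i j
    using sum.atLeastLessThan_concat[of 0 i "i + j" "\<lambda>k. xs ! (k mod length xs)"]
    by (simp add: H_def atLeast0LessThan)
  have rot: "sum_list (take j (rotate i xs)) = H (i + j) - H i" if "j \<le> length xs" for i j
    using sum_list_take_rotate[OF that] by (simp add: diff)
  have "sum_list (rotate1 ys) = sum_list ys" for ys :: "int list"
    by (cases ys) simp_all
  then have "sum_list (rotate i xs) = sum_list xs" for i
    by (induction i) simp_all
  then have "H (i + length xs) = H i + sum_list xs" for i
    using rot[of "length xs" i] by simp
  then show ?thesis
    using sum_future_min_jumps[of "length xs" "sum_list xs" H] assms by (simp add: rot)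
qed

text \<open>Double counting: the \<open>m\<close> rotations of each word together admit exactly
  \<open>d\<close> thresholds \<open>c\<close>. Rotations are indexed by \<open>i < m\<close> and
  counted with multiplicity, which covers periodic words as well.\<close>

lemma cycle_lemma:
  fixes f :: "'a \<Rightarrow> int" and W :: "'a list set"
  assumes fin: "finite W" and m: "m > 0" and d: "d \<ge> 0"
    and len: "\<And>w. w \<in> W \<Longrightarrow> length w = m"
    and total: "\<And>w. w \<in> W \<Longrightarrow> sum_list (map f w) = d"
    and closed: "\<And>w. w \<in> W \<Longrightarrow> rotate1 w \<in> W"
  shows "m * (\<Sum>c\<in>{1..d}. card {w \<in> W. \<forall>j\<in>{1..m}. c \<le> sum_list (map f (take j w))})
    = nat d * card W"
proof -
  define J where
    "J w = card {c \<in> {1..d}. \<forall>j\<in>{1..m}. c \<le> sum_list (map f (take j w))}" for w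
  \<comment> \<open>An injective map of a finite set into itself permutes it, so every rotation
    merely reorders a sum over \<open>W\<close>.\<close>
  have "inj_on rotate1 W"
    using inj_rotate1 by (rule inj_on_subset) simp
  moreover from this have "rotate1 ` W = W"
    using fin closed by (intro endo_inj_surj image_subsetI)
  ultimately have "bij_betw rotate1 W W"
    by (simp add: bij_betw_def)
  then have rot: "bij_betw (rotate i) W W" for i
    unfolding rotate_def by (rule bij_betw_funpow)
  have "(\<Sum>i<m. J (rotate i w)) = nat d" if "w \<in> W" for w
  proof -
    have "map f w \<noteq> []" using len[OF that] m by auto
    then show ?thesis
      using sum_card_rotations[of "map f w"] len[OF that] total[OF that] d
      by (simp add: J_def rotate_map take_map)
  qed
  then have "nat d * card W = (\<Sum>w\<in>W. \<Sum>i<m. J (rotate i w))"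
    by simp
  also have "\<dots> = (\<Sum>i<m. \<Sum>w\<in>W. J (rotate i w))"
    by (rule sum.swap)
  also have "\<dots> = (\<Sum>i<m. \<Sum>w\<in>W. J w)"
    by (intro sum.cong refl sum.reindex_bij_betw rot)
  also have "\<dots> = m * (\<Sum>w\<in>W. J w)" by simp
  \<comment> \<open>Count the pairs of a word and an admissible threshold by threshold instead of by
    word.\<close>
  also have "(\<Sum>w\<in>W. J w)
      = (\<Sum>c\<in>{1..d}. card {w \<in> W. \<forall>j\<in>{1..m}. c \<le> sum_list (map f (take j w))})"
    unfolding J_def by (rule sum_multicount_gen) (use fin in auto)
  finally show ?thesis by simp
qed

section \<open>Heights\<close>

primrec rise :: "step \<Rightarrow> int" where
  "rise Right = -2"
| "rise Up = 3"

definition ht :: "path \<Rightarrow> int" where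
  "ht p = sum_list (map rise p)"

lemma ht_simps [simp]:
  "ht [] = 0" "ht (s # p) = rise s + ht p" "ht (p @ q) = ht p + ht q" "ht (rev p) = ht p"
  by (simp_all add: ht_def flip: rev_map)

lemma ht_drop: "ht (drop i p) = ht p - ht (take i p)"
  using ht_simps(3)[of "take i p" "drop i p"] by simp

text \<open>For total height 0, reversal thus negates the inner heights and reads them backwards,
  exchanging the two sides of the diagonal.\<close>

lemma ht_take_rev: "ht (take i (rev p)) = ht p - ht (take (length p - i) p)"
  by (simp add: take_rev ht_drop)

lemma ht_take_Suc: "i < length p \<Longrightarrow> ht (take (Suc i) p) = ht (take i p) + rise (p ! i)"
  by (simp add: take_Suc_conv_app_nth)

lemma ht_eq_displacement:
  "ht p = 3 * snd (sum_list (map displacement p)) - 2 * fst (sum_list (map displacement p))"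
proof (induction p)
  case (Cons s p)
  then show ?case by (cases s) simp_all
qed simp

lemma ht_vertex: "ht (take i p) = 3 * snd (vertex p i) - 2 * fst (vertex p i)"
  by (simp add: vertex_def ht_eq_displacement)

lemma diagonal_ht:
  "on_diagonal (vertex p i) \<longleftrightarrow> ht (take i p) = 0"
  "above_diagonal (vertex p i) \<longleftrightarrow> ht (take i p) > 0"
  "below_diagonal (vertex p i) \<longleftrightarrow> ht (take i p) < 0"
  unfolding on_diagonal_def above_diagonal_def below_diagonal_def ht_vertex
  by linarith+

text \<open>The equations \<open>x + y = 5n\<close> and \<open>3y - 2x = 0\<close> have
  \<open>(3n, 2n)\<close> as their only solution.\<close>

lemma bridge_iff: "bridge n p \<longleftrightarrow> length p = 5 * n \<and> ht p = 0"
  using sum_list_displacement[of p] ht_eq_displacement[of p]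
  by (auto simp: bridge_def vertex_def prod_eq_iff)

lemma finite_paths_length: "finite {p :: path. length p = m \<and> Q p}"
proof (rule finite_subset)
  have "s \<in> {Right, Up}" for s by (cases s) simp_all
  then show "{p. length p = m \<and> Q p} \<subseteq> {p. set p \<subseteq> {Right, Up} \<and> length p = m}"
    by auto
qed (simp add: finite_lists_length_eq)

lemma ht_count_list: "ht p = 5 * int (count_list p Up) - 2 * int (length p)"
proof (induction p)
  case (Cons s p)
  then show ?case by (cases s) simp_all
qed simp

text \<open>Splitting by the first step is Pascal's rule.\<close>

lemma card_paths_count_list:
  "card {p. length p = m \<and> count_list p Up = k} = m choose k"
proof (induction m arbitrary: k)
  case 0
  have "{p. length p = 0 \<and> count_list p Up = k} = (if k = 0 then {[]} else {})" by auto
  then show ?case by (cases k) simp_all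
next
  case (Suc m)
  let ?L = "\<lambda>m k. {p. length p = m \<and> count_list p Up = k}"
  show ?case
  proof (cases k)
    case 0
    have "?L (Suc m) 0 = (#) Right ` ?L m 0"
    proof (intro set_eqI)
      fix p show "p \<in> ?L (Suc m) 0 \<longleftrightarrow> p \<in> (#) Right ` ?L m 0"
        by (cases p; cases "hd p") auto
    qed
    then show ?thesis using Suc[of 0] 0 by (simp add: card_image)
  next
    case (Suc k')
    have "?L (Suc m) (Suc k') = (#) Up ` ?L m k' \<union> (#) Right ` ?L m (Suc k')"
    proof (intro set_eqI)
      fix p show "p \<in> ?L (Suc m) (Suc k') \<longleftrightarrow>
          p \<in> (#) Up ` ?L m k' \<union> (#) Right ` ?L m (Suc k')"
        by (cases p; cases "hd p") auto
    qed
    moreover have "card ((#) Up ` ?L m k' \<union> (#) Right ` ?L m (Suc k'))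
        = card (?L m k') + card (?L m (Suc k'))"
      by (subst card_Un_disjoint) (auto simp: card_image finite_paths_length)
    ultimately show ?thesis using Suc.IH Suc by simp
  qed
qed

section \<open>Excursions\<close>

definition excursions :: "int \<Rightarrow> nat \<Rightarrow> path set" where
  "excursions c N =
    {p. length p = N \<and> ht p = 0 \<and> (\<forall>i. 0 < i \<and> i < N \<longrightarrow> c \<le> ht (take i p))}"

lemma finite_excursions: "finite (excursions c N)"
  unfolding excursions_def by (rule finite_paths_length)

lemma minimal_Duchon_path_iff:
  assumes "n \<ge> 1"
  shows "minimal_Duchon_path n p \<longleftrightarrow> p \<in> excursions 1 (5 * n)"
  using assms by (auto simp: minimal_Duchon_path_def bridge_iff diagonal_ht excursions_def
      int_one_le_iff_zero_less)

text \<open>The height before the last step is positive, so that step is \<open>Right\<close> and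
  starts at height 2. Without it, the bound on inner vertices becomes a bound on all nonempty
  prefixes, as the cycle lemma requires.\<close>

lemma excursions_snoc:
  assumes "c \<ge> 1" and "m > 0"
  shows "excursions c (Suc m) = (\<lambda>w. w @ [Right]) `
    {w. length w = m \<and> ht w = 2 \<and> (\<forall>j\<in>{1..m}. c \<le> ht (take j w))}" (is "_ = ?f ` ?W")
proof
  show "?f ` ?W \<subseteq> excursions c (Suc m)"
    by (auto simp: excursions_def)
  show "excursions c (Suc m) \<subseteq> ?f ` ?W"
  proof
    fix p assume p: "p \<in> excursions c (Suc m)"
    then have len: "length p = Suc m" and "ht p = 0" by (auto simp: excursions_def)
    then obtain w s where ws: "p = w @ [s]" "length w = m"
      by (metis length_Suc_conv_rev)
    have above: "c \<le> ht (take j w)" if "j \<in> {1..m}" for j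
      using p that ws by (force simp: excursions_def)
    have "1 \<le> ht w" using above[of m] ws assms by simp
    then have "s = Right" using \<open>ht p = 0\<close> ws by (cases s) auto
    then show "p \<in> ?f ` ?W" using ws above \<open>ht p = 0\<close> by auto
  qed
qed

text \<open>Dropping the last step leaves total height 2, so the cycle lemma sums over the
  thresholds 1 and 2. This is why the two families are evaluated together.\<close>

lemma card_excursions:
  assumes "n \<ge> 1"
  shows "(5 * n - 1) * (card (excursions 1 (5 * n)) + card (excursions 2 (5 * n)))
    = 2 * ((5 * n - 1) choose (2 * n))"
proof -
  define m where "m = 5 * n - 1"
  have m: "m > 0" "5 * n = Suc m" using assms by (auto simp: m_def)
  define W where "W = {w. length w = m \<and> ht w = 2}"
  have fin: "finite W" unfolding W_def by (rule finite_paths_length)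
  \<comment> \<open>With \<open>k\<close> up steps the height is \<open>5k - 2(5n - 1)\<close>,
    which equals 2 exactly for \<open>k = 2n\<close>.\<close>
  have "W = {w. length w = m \<and> count_list w Up = 2 * n}"
    using m by (auto simp: W_def ht_count_list)
  then have "card W = m choose (2 * n)" by (simp add: card_paths_count_list)
  moreover have "card (excursions c (5 * n)) = card {w \<in> W. \<forall>j\<in>{1..m}. c \<le> ht (take j w)}"
    if "c \<ge> 1" for c
    unfolding m(2) excursions_snoc[OF that m(1)] W_def
    by (subst card_image) (auto simp: inj_on_def)
  moreover have "ht (rotate1 w) = ht w" for w by (cases w) simp_all
  then have "m * (\<Sum>c\<in>{1..2}. card {w \<in> W. \<forall>j\<in>{1..m}. c \<le> sum_list (map rise (take j w))})
      = nat 2 * card W"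
    by (intro cycle_lemma fin m) (auto simp: W_def ht_def)
  moreover have "{1..2::int} = {1, 2}" by auto
  ultimately show ?thesis by (simp add: m_def ht_def)
qed

section \<open>Descents\<close>

definition descents :: "int \<Rightarrow> path set" where
  "descents a = {p. a + ht p = 0 \<and> (\<forall>i < length p. a + ht (take i p) > 0)}"

text \<open>The \<open>+ 1\<close> leaves room for the \<open>Up\<close> step that stands before or
  between the two descents.\<close>

definition descent_pairs :: "nat \<Rightarrow> int \<Rightarrow> int \<Rightarrow> (path \<times> path) set" where
  "descent_pairs N a b =
    {(u, v). u \<in> descents a \<and> v \<in> descents b \<and> length u + length v + 1 = N}"

lemma finite_descent_pairs: "finite (descent_pairs N a b)"
proof (rule finite_subset)
  show "descent_pairs N a b \<subseteq> (\<Union>k\<le>N. {p. length p = k \<and> True}) \<times> (\<Union>k\<le>N. {p. length p = k \<and> True})"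
    by (auto simp: descent_pairs_def)
qed (intro finite_cartesian_product finite_UN_I finite_atMost finite_paths_length)

text \<open>A descent stops at its first zero, so a proper prefix of a descent still has positive
  height and is not itself a descent from \<open>a\<close>.\<close>

lemma descents_prefix_free:
  assumes "u \<in> descents a" "u' \<in> descents a" "u @ v = u' @ v'"
  shows "u = u'"
proof -
  have False if "length x < length y" "x \<in> descents a" "y \<in> descents a" "x @ z = y @ z'"
    for x y z z'
  proof -
    have "take (length x) y = x"
      using that(1,4) by (metis append_eq_append_conv_if less_imp_le_nat)
    then show False using that(1-3) by (force simp: descents_def)
  qed
  then have "length u = length u'" using assms by (metis linorder_neqE_nat)
  then show ?thesis using assms(3) by simp
qed

text \<open>The first step leads to height 3. From there to the first visit to height 1 the path,
  measured from level 1, is a descent from 2; the rest descends from 1 to 0.\<close>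

lemma excursions_1_diff_2:
  assumes "N > 1"
  shows "excursions 1 N - excursions 2 N = (\<lambda>(u, v). Up # u @ v) ` descent_pairs N 2 1"
proof (intro set_eqI iffI)
  fix p assume p: "p \<in> excursions 1 N - excursions 2 N"
  then have len: "length p = N" and ht0: "ht p = 0"
    and pos: "\<And>i. 0 < i \<Longrightarrow> i < N \<Longrightarrow> 1 \<le> ht (take i p)"
    by (auto simp: excursions_def)
  define Q where "Q k \<longleftrightarrow> 0 < k \<and> k < N \<and> ht (take k p) = 1" for k
  have "\<exists>k. Q k"
  proof -
    obtain k where "0 < k" "k < N" "\<not> 2 \<le> ht (take k p)"
      using p by (auto simp: excursions_def)
    then show ?thesis using pos[of k] unfolding Q_def by (intro exI[of _ k]) auto
  qed
  then obtain k where "Q k" and first: "\<And>i. i < k \<Longrightarrow> \<not> Q i"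
    by (subst (asm) exists_least_iff) blast
  then have k: "0 < k" "k < N" "ht (take k p) = 1" by (simp_all add: Q_def)
  obtain s q where sq: "p = s # q" using len assms by (cases p) auto
  have "s = Up" using pos[of 1] assms sq by (cases s) auto
  define u v where "u = take (k - 1) q" and "v = drop (k - 1) q"
  have puv: "p = Up # u @ v" using sq \<open>s = Up\<close> by (simp add: u_def v_def)
  have lenu: "length u = k - 1" using sq len k by (simp add: u_def)
  have tk: "take k p = Up # u" using k lenu by (simp add: puv take_Cons')
  have "u \<in> descents 2"
  proof -
    have "2 + ht (take i u) > 0" if "i < length u" for i
    proof -
      have "take (Suc i) p = Up # take i u" using that by (simp add: puv)
      \<comment> \<open>Before the first visit to 1 the heights are at least 2.\<close>
      moreover have "1 \<le> ht (take (Suc i) p)" "ht (take (Suc i) p) \<noteq> 1"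
        using pos[of "Suc i"] first[of "Suc i"] that lenu k by (auto simp: Q_def)
      ultimately show ?thesis by simp
    qed
    then show ?thesis using k tk by (simp add: descents_def)
  qed
  moreover have "v \<in> descents 1"
  proof -
    have "1 + ht (take i v) > 0" if "i < length v" for i
    proof -
      have "take (k + i) p = take k p @ take i v"
        using k lenu by (simp add: puv take_Cons')
      moreover have "k + i < N" using that lenu k len by (simp add: puv)
      ultimately show ?thesis using pos[of "k + i"] k by simp
    qed
    moreover have "1 + ht v = 0" using ht0 tk k by (simp add: puv)
    ultimately show ?thesis by (simp add: descents_def)
  qed
  moreover have "length u + length v + 1 = N" using len by (simp add: puv)
  ultimately show "p \<in> (\<lambda>(u, v). Up # u @ v) ` descent_pairs N 2 1"
    by (force simp: descent_pairs_def puv)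
next
  fix p assume "p \<in> (\<lambda>(u, v). Up # u @ v) ` descent_pairs N 2 1"
  then obtain u v where p: "p = Up # u @ v" and u: "u \<in> descents 2" and v: "v \<in> descents 1"
    and len: "length u + length v + 1 = N"
    by (auto simp: descent_pairs_def)
  have htu: "ht u = -2" and htv: "ht v = -1" using u v by (auto simp: descents_def)
  have "v \<noteq> []" using htv by auto
  have inner: "1 \<le> ht (take i p)" if i: "0 < i" "i < N" for i
  proof -
    obtain j where j: "i = Suc j" using i by (cases i) auto
    show ?thesis
    proof (cases "j < length u")
      case True
      then have "2 + ht (take j u) > 0" using u by (simp add: descents_def)
      then show ?thesis using True by (simp add: p j)
    next
      case False
      then have "1 + ht (take (j - length u) v) > 0"
        using v i len j by (simp add: descents_def)
      then show ?thesis using False htu by (simp add: p j)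
    qed
  qed
  \<comment> \<open>The joint between \<open>u\<close> and \<open>v\<close> has height 1 and is an
    inner vertex because \<open>v\<close> is nonempty.\<close>
  have "ht (take (Suc (length u)) p) = 1" using htu by (simp add: p)
  moreover have "Suc (length u) < N" using len \<open>v \<noteq> []\<close> by (cases v) auto
  ultimately have "p \<notin> excursions 2 N"
    by (intro notI) (auto simp: excursions_def)
  moreover have "p \<in> excursions 1 N"
    using inner len htu htv by (simp add: excursions_def p)
  ultimately show "p \<in> excursions 1 N - excursions 2 N" by simp
qed

lemma card_excursions_1:
  assumes "N > 1"
  shows "card (excursions 1 N) = card (excursions 2 N) + card (descent_pairs N 2 1)"
proof -
  have "inj_on (\<lambda>(u, v). Up # u @ v) (descent_pairs N 2 1)"
    by (auto simp: inj_on_def descent_pairs_def dest: descents_prefix_free)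
  then have "card (excursions 1 N - excursions 2 N) = card (descent_pairs N 2 1)"
    by (simp add: excursions_1_diff_2[OF assms] card_image)
  moreover have "excursions 2 N \<subseteq> excursions 1 N" by (force simp: excursions_def)
  then have "card (excursions 1 N) = card (excursions 2 N) + card (excursions 1 N - excursions 2 N)"
    by (metis card_Diff_subset card_mono finite_excursions le_add_diff_inverse finite_subset)
  ultimately show ?thesis by simp
qed

section \<open>Valved minimal bridges\<close>

text \<open>The index \<open>k\<close> marks the last vertex before the positive stretch. Vertex 0
  is exempt from negativity, so \<open>k = 0\<close> means all inner vertices are above the
  diagonal, and \<open>k = N - 1\<close> all below.\<close>

definition crossing_paths :: "nat \<Rightarrow> nat \<Rightarrow> path set" where
  "crossing_paths N k = {p. length p = N \<and> ht p = 0 \<and>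
    (\<forall>i. 0 < i \<and> i \<le> k \<longrightarrow> ht (take i p) < 0) \<and>
    (\<forall>i. k < i \<and> i < N \<longrightarrow> ht (take i p) > 0)}"

lemma crossing_paths_disjoint:
  assumes "k < N" "l < N" "k \<noteq> l"
  shows "crossing_paths N k \<inter> crossing_paths N l = {}"
proof -
  have "crossing_paths N k \<inter> crossing_paths N l = {}" if "k < l" "l < N" for k l
  proof -
    have "ht (take l p) > 0" if "p \<in> crossing_paths N k" for p
      using that \<open>k < l\<close> \<open>l < N\<close> by (simp add: crossing_paths_def)
    moreover have "ht (take l p) < 0" if "p \<in> crossing_paths N l" for p
      using that \<open>k < l\<close> by (simp add: crossing_paths_def)
    ultimately show ?thesis by fastforce
  qed
  then show ?thesis using assms by (metis inf_commute linorder_neqE_nat)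
qed

text \<open>Once an inner vertex is positive, the valve forbids crossing down and minimality forbids
  height 0, so all later inner vertices are positive.\<close>

lemma valved_minimal_bridge_iff:
  assumes "n \<ge> 1"
  shows "valved_minimal_bridge n p \<longleftrightarrow> (\<exists>k < 5 * n. p \<in> crossing_paths (5 * n) k)"
proof
  let ?N = "5 * n"
  let ?h = "\<lambda>i. ht (take i p)"
  assume "valved_minimal_bridge n p"
  then have len: "length p = ?N" and ht0: "ht p = 0"
    and nz: "\<And>i. 0 < i \<Longrightarrow> i < ?N \<Longrightarrow> ?h i \<noteq> 0"
    and valve: "\<And>i. 0 < i \<Longrightarrow> i < ?N \<Longrightarrow> p ! i = Right \<Longrightarrow> ?h i > 0 \<Longrightarrow> ?h (Suc i) \<ge> 0"
    by (auto simp: valved_minimal_bridge_def minimal_bridge_def valved_path_def bridge_iff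
        diagonal_ht not_less)
  have stay: "?h (Suc i) > 0" if "0 < i" "Suc i < ?N" "?h i > 0" for i
  proof -
    have "?h (Suc i) \<ge> 0"
    proof (cases "p ! i")
      case Right
      then show ?thesis using valve[of i] that by simp
    next
      case Up
      then show ?thesis using that len by (simp add: ht_take_Suc)
    qed
    then show ?thesis using nz[of "Suc i"] that by simp
  qed
  show "\<exists>k < ?N. p \<in> crossing_paths ?N k"
  proof (cases "\<exists>i. 0 < i \<and> i < ?N \<and> ?h i > 0")
    case True
    \<comment> \<open>The first positive inner vertex; the index of the class is its predecessor,
      possibly 0.\<close>
    define l where "l = (LEAST i. 0 < i \<and> i < ?N \<and> ?h i > 0)"
    have l: "0 < l" "l < ?N" "?h l > 0"
      using LeastI_ex[OF True] unfolding l_def by auto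
    have "?h i < 0" if "0 < i" "i \<le> l - 1" for i
    proof -
      have "\<not> (0 < i \<and> i < ?N \<and> ?h i > 0)"
        using that l by (intro not_less_Least) (auto simp: l_def)
      then show ?thesis using that l nz[of i] by force
    qed
    moreover have "?h i > 0" if "l \<le> i" "i < ?N" for i
      using that
    proof (induction i rule: dec_induct)
      case base then show ?case using l by simp
    next
      case (step i)
      then show ?case using stay[of i] l by simp
    qed
    ultimately have "p \<in> crossing_paths ?N (l - 1)"
      using len ht0 l by (auto simp: crossing_paths_def)
    then show ?thesis using l by (intro exI[of _ "l - 1"]) auto
  next
    case False
    then have "?h i < 0" if "0 < i" "i < ?N" for i
      using nz[of i] that by force
    then have "p \<in> crossing_paths ?N (?N - 1)"
      using len ht0 assms by (auto simp: crossing_paths_def)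
    then show ?thesis using assms by (intro exI[of _ "?N - 1"]) auto
  qed
next
  assume "\<exists>k < 5 * n. p \<in> crossing_paths (5 * n) k"
  then obtain k where k: "k < 5 * n" "length p = 5 * n" "ht p = 0"
    and neg: "\<And>i. 0 < i \<Longrightarrow> i \<le> k \<Longrightarrow> ht (take i p) < 0"
    and pos: "\<And>i. k < i \<Longrightarrow> i < 5 * n \<Longrightarrow> ht (take i p) > 0"
    by (auto simp: crossing_paths_def)
  have "ht (take i p) \<noteq> 0" if "0 < i" "i < 5 * n" for i
    using that neg[of i] pos[of i] by (cases "i \<le> k") auto
  moreover have "\<not> ht (take (Suc i) p) < 0"
    if "0 < i" "i < 5 * n" "ht (take i p) = 0 \<or> ht (take i p) > 0" for i
  proof (cases "Suc i = 5 * n")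
    \<comment> \<open>The last step may come down to the diagonal, but not below it.\<close>
    case True
    then show ?thesis using k by simp
  next
    case False
    have "k < i" using neg[of i] that by force
    then show ?thesis using pos[of "Suc i"] that False by simp
  qed
  ultimately show "valved_minimal_bridge n p"
    using k assms by (auto simp: valved_minimal_bridge_def minimal_bridge_def valved_path_def
        bridge_iff diagonal_ht)
qed

lemma crossing_paths_0: "crossing_paths N 0 = excursions 1 N"
  by (auto simp: crossing_paths_def excursions_def int_one_le_iff_zero_less)

lemma rev_crossing_paths_0:
  assumes "N > 0"
  shows "rev ` crossing_paths N 0 = crossing_paths N (N - 1)"
proof -
  have "rev p \<in> crossing_paths N (N - 1)" if "p \<in> crossing_paths N 0" for p
    using that assms by (auto simp: crossing_paths_def ht_take_rev)
  moreover have "rev p \<in> crossing_paths N 0" if "p \<in> crossing_paths N (N - 1)" for p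
    using that assms by (auto simp: crossing_paths_def ht_take_rev)
  ultimately show ?thesis by (metis image_eqI image_subsetI rev_rev_ident subsetI subset_antisym)
qed

text \<open>Reversing \<open>u\<close> gives a path from 0 to \<open>-a\<close> that is negative
  after its start. Since \<open>Up\<close> rises by \<open>a + b\<close>, it arrives at height
  \<open>b\<close>, from which \<open>v\<close> descends.\<close>

lemma crossing_join:
  assumes u: "u \<in> descents a" and v: "v \<in> descents b" and ab: "a > 0" "b > 0" "a + b = 3"
    and len: "length u + length v + 1 = N"
  shows "rev u @ Up # v \<in> crossing_paths N (length u)"
proof -
  have htu: "ht u = - a" and htv: "ht v = - b" using u v by (auto simp: descents_def)
  have "ht (take i (rev u @ Up # v)) < 0" if "0 < i" "i \<le> length u" for i
  proof -
    have "a + ht (take (length u - i) u) > 0" using u that by (simp add: descents_def)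
    then show ?thesis using that htu by (simp add: ht_take_rev)
  qed
  moreover have "ht (take i (rev u @ Up # v)) > 0" if i: "length u < i" "i < N" for i
  proof -
    obtain j where j: "i = length u + Suc j"
      using i(1) by (auto dest: less_imp_Suc_add)
    have "b + ht (take j v) > 0" using v i j len by (simp add: descents_def)
    then show ?thesis using htu ab by (simp add: j)
  qed
  ultimately show ?thesis using htu htv ab len by (auto simp: crossing_paths_def)
qed

text \<open>The step leaving vertex \<open>k\<close> goes from a negative to a positive height, so
  it is \<open>Up\<close> and runs from -2 to 1 or from -1 to 2.\<close>

lemma crossing_split:
  assumes p: "p \<in> crossing_paths N k" and k: "0 < k" "k < N - 1"
  obtains u v where "p = rev u @ Up # v" "(u, v) \<in> descent_pairs N 2 1 \<union> descent_pairs N 1 2"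
proof -
  have len: "length p = N" and ht0: "ht p = 0"
    and neg: "\<And>i. 0 < i \<Longrightarrow> i \<le> k \<Longrightarrow> ht (take i p) < 0"
    and pos: "\<And>i. k < i \<Longrightarrow> i < N \<Longrightarrow> ht (take i p) > 0"
    using p by (auto simp: crossing_paths_def)
  have step: "ht (take (Suc k) p) = ht (take k p) + rise (p ! k)"
    using k len by (simp add: ht_take_Suc)
  have sgn: "ht (take k p) < 0" "ht (take (Suc k) p) > 0"
    using neg[of k] pos[of "Suc k"] k by auto
  have up: "p ! k = Up" using step sgn by (cases "p ! k") auto
  define u v where "u = rev (take k p)" and "v = drop (Suc k) p"
  have puv: "p = rev u @ Up # v"
    using id_take_nth_drop[of k p] k len up by (simp add: u_def v_def)
  have lens: "length u = k" "length v = N - 1 - k" using k len by (auto simp: u_def v_def)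
  define a where "a = - ht (take k p)"
  have a: "a = 2 \<or> a = 1" using step sgn up by (auto simp: a_def)
  have "u \<in> descents a"
  proof -
    have "a + ht (take i u) > 0" if "i < length u" for i
    proof -
      have "ht (take i u) = ht (take k p) - ht (take (k - i) p)"
        using lens k len by (simp add: u_def ht_take_rev min_def)
      then show ?thesis using neg[of "k - i"] that lens by (simp add: a_def)
    qed
    then show ?thesis by (simp add: descents_def a_def u_def)
  qed
  moreover have "v \<in> descents (3 - a)"
  proof -
    have "3 - a + ht (take i v) > 0" if "i < length v" for i
    proof -
      have "take (Suc k + i) p = take (Suc k) p @ take i v" by (simp only: take_add v_def)
      then have "ht (take (Suc k + i) p) = 3 - a + ht (take i v)"
        using step up by (simp add: a_def)
      then show ?thesis using pos[of "Suc k + i"] that lens by simp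
    qed
    moreover have "3 - a + ht v = 0"
      using ht0 step up by (simp add: v_def ht_drop a_def)
    ultimately show ?thesis by (simp add: descents_def)
  qed
  moreover have "length u + length v + 1 = N" using lens k by simp
  ultimately have "(u, v) \<in> descent_pairs N 2 1 \<union> descent_pairs N 1 2"
    using a by (auto simp: descent_pairs_def)
  with puv show thesis by (rule that)
qed

text \<open>Joining is a bijection from the pairs with heights 2, 1 or 1, 2, and swapping the
  components shows that both orders are equally frequent.\<close>

lemma card_crossing_paths_inner:
  "card (\<Union>k\<in>{0<..<N - 1}. crossing_paths N k) = 2 * card (descent_pairs N 2 1)"
proof -
  let ?P = "descent_pairs N 2 1 \<union> descent_pairs N 1 2"
  let ?j = "\<lambda>(u, v). rev u @ Up # v"
  have join: "rev u @ Up # v \<in> crossing_paths N (length u)" "0 < length u" "length u < N - 1"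
    if "(u, v) \<in> ?P" for u v
  proof -
    have "u \<noteq> []" "v \<noteq> []" using that by (auto simp: descent_pairs_def descents_def)
    moreover have "length u + length v + 1 = N" using that by (auto simp: descent_pairs_def)
    ultimately show "0 < length u" "length u < N - 1" by (auto simp: neq_Nil_conv)
    show "rev u @ Up # v \<in> crossing_paths N (length u)"
      using that by (auto simp: descent_pairs_def intro: crossing_join)
  qed
  have "inj_on ?j ?P"
  proof (rule inj_onI)
    fix x y assume xy: "x \<in> ?P" "y \<in> ?P" "?j x = ?j y"
    obtain u v u' v' where x: "x = (u, v)" and y: "y = (u', v')" by (cases x, cases y)
    have eq: "rev u @ Up # v = rev u' @ Up # v'" using xy x y by simp
    \<comment> \<open>The length of \<open>u\<close> is the crossing index, which the joined path
      determines by disjointness of the classes.\<close>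
    have "length u = length u'"
      using join[of u v] join[of u' v'] xy(1,2) eq
        crossing_paths_disjoint[of "length u" N "length u'"]
      unfolding x y by force
    then show "x = y" using eq x y by simp
  qed
  moreover have "(\<Union>k\<in>{0<..<N - 1}. crossing_paths N k) = ?j ` ?P"
  proof (intro equalityI subsetI)
    fix p assume "p \<in> (\<Union>k\<in>{0<..<N - 1}. crossing_paths N k)"
    then obtain k where "p \<in> crossing_paths N k" "0 < k" "k < N - 1" by auto
    then obtain u v where "p = rev u @ Up # v" "(u, v) \<in> ?P" by (rule crossing_split)
    then show "p \<in> ?j ` ?P" by (intro image_eqI[of _ _ "(u, v)"]) auto
  next
    fix p assume "p \<in> ?j ` ?P"
    then obtain u v where "p = rev u @ Up # v" "(u, v) \<in> ?P" by auto
    then show "p \<in> (\<Union>k\<in>{0<..<N - 1}. crossing_paths N k)"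
      using join[of u v] by auto
  qed
  ultimately have "card (\<Union>k\<in>{0<..<N - 1}. crossing_paths N k) = card ?P"
    by (simp add: card_image)
  also have "\<dots> = card (descent_pairs N 2 1) + card (descent_pairs N 1 2)"
    by (rule card_Un_disjoint[OF finite_descent_pairs finite_descent_pairs])
      (auto simp: descent_pairs_def descents_def)
  also have "descent_pairs N 1 2 = prod.swap ` descent_pairs N 2 1"
    by (force simp: descent_pairs_def image_iff)
  also have "card \<dots> = card (descent_pairs N 2 1)" by (simp add: card_image)
  finally show ?thesis by simp
qed

text \<open>The crossing index 0 gives the minimal Duchon paths, the last index their reversals, and
  the inner indices the joined descents.\<close>

lemma num_valved_minimal_bridges_eq:
  assumes "n \<ge> 1"
  shows "num_valved_minimal_bridges n
    = 2 * card (excursions 1 (5 * n)) + 2 * card (descent_pairs (5 * n) 2 1)"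
proof -
  let ?N = "5 * n"
  let ?X = "\<Union>k\<in>{0<..<?N - 1}. crossing_paths ?N k"
  have fin: "finite (crossing_paths ?N k)" for k
    unfolding crossing_paths_def by (rule finite_paths_length)
  have finX: "finite ?X" using fin by (intro finite_UN_I) simp_all
  have disj0: "crossing_paths ?N 0 \<inter> (crossing_paths ?N (?N - 1) \<union> ?X) = {}"
  proof -
    have "crossing_paths ?N 0 \<inter> crossing_paths ?N k = {}" if "k \<in> {0<..<?N}" for k
      by (rule crossing_paths_disjoint) (use that in auto)
    moreover have "?N - 1 \<in> {0<..<?N}" "{0<..<?N - 1} \<subseteq> {0<..<?N}" using assms by auto
    ultimately show ?thesis by blast
  qed
  have disj1: "crossing_paths ?N (?N - 1) \<inter> ?X = {}"
  proof -
    have "crossing_paths ?N (?N - 1) \<inter> crossing_paths ?N k = {}" if "k \<in> {0<..<?N - 1}" for k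
      by (rule crossing_paths_disjoint) (use that in auto)
    then show ?thesis by blast
  qed
  have "{p. valved_minimal_bridge n p} = (\<Union>k\<in>{..<?N}. crossing_paths ?N k)"
    using valved_minimal_bridge_iff[OF assms] by auto
  also have "{..<?N} = {0, ?N - 1} \<union> {0<..<?N - 1}" using assms by auto
  also have "(\<Union>k\<in>\<dots>. crossing_paths ?N k)
      = crossing_paths ?N 0 \<union> (crossing_paths ?N (?N - 1) \<union> ?X)"
    by blast
  also have "card \<dots> = card (crossing_paths ?N 0) + card (crossing_paths ?N (?N - 1) \<union> ?X)"
    by (rule card_Un_disjoint[OF fin finite_UnI[OF fin finX] disj0])
  also have "card (crossing_paths ?N (?N - 1) \<union> ?X)
      = card (crossing_paths ?N (?N - 1)) + card ?X"
    by (rule card_Un_disjoint[OF fin finX disj1])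
  also have "card (crossing_paths ?N (?N - 1)) = card (crossing_paths ?N 0)"
    using rev_crossing_paths_0[of ?N] card_image[OF inj_on_rev, of "crossing_paths ?N 0"] assms
    by simp
  finally show ?thesis
    using card_crossing_paths_inner[of ?N]
    by (simp add: num_valved_minimal_bridges_def crossing_paths_0)
qed

theorem theorem16:
  fixes n :: nat
  assumes "n \<ge> 1"
  shows "real (num_valved_minimal_bridges n) =
    6 * real (num_minimal_Duchon_paths n)
      - 4 / (5 * real n - 1) * real ((5 * n - 1) choose (2 * n))"
proof -
  let ?E = "\<lambda>c. real (card (excursions c (5 * n)))"
  have D: "num_minimal_Duchon_paths n = card (excursions 1 (5 * n))"
    by (simp add: num_minimal_Duchon_paths_def minimal_Duchon_path_iff[OF assms])
  \<comment> \<open>By \<open>card_excursions_1\<close> the pairs number \<open>?E 1 - ?E 2\<close>;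
    the total is arranged to expose the sum \<open>?E 1 + ?E 2\<close> known from the cycle
    lemma.\<close>
  have V: "real (num_valved_minimal_bridges n) = 6 * ?E 1 - 2 * (?E 1 + ?E 2)"
    using num_valved_minimal_bridges_eq[OF assms] card_excursions_1[of "5 * n"] assms by simp
  have "real (5 * n - 1) * (?E 1 + ?E 2) = 2 * real ((5 * n - 1) choose (2 * n))"
    using arg_cong[OF card_excursions[OF assms], of real] by simp
  moreover have "real (5 * n - 1) = 5 * real n - 1" "5 * real n - 1 > 0"
    using assms by (auto simp: of_nat_diff)
  ultimately have "?E 1 + ?E 2 = 2 / (5 * real n - 1) * real ((5 * n - 1) choose (2 * n))"
    by (simp add: field_simps)
  then show ?thesis by (simp add: V D)
qed

end
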